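(* Let $G$ be any group and let $G^{\vartriangleleft}=\{H \mid H\unlhd G\}$ be the set of all normal subgroups of $G$, equipped with the operation $x\ast y=\{ab\mid a\in x,\ b\in y\}$. Then $(G^{\vartriangleleft},\ast)$ is a commutative monoid. Moreover, $\ast$ is self-distributive and every element of $G^{\vartriangleleft}$ is idempotent with respect to $\ast$. Hence $(G^{\vartriangleleft},\ast)$ is a commutative pseudoquandle.
   Context: A pseudoquandle is a set $Q$ with a closed binary operation $\ast:Q\times Q\to Q$ such that (i) $q\ast q=q$ for all $q\in Q$, and (ii) $(p\ast q)\ast r=(p\ast r)\ast(q\ast r)$ for all $p,q,r\in Q$ (self-distributivity from the right). It is commutative if $p\ast q=q\ast p$ for all $p,q\in Q$. *)

theory Defs
  imports "HOL-Algebra.Coset"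
begin

definition self_distributive_on :: "'q set \<Rightarrow> ('q \<Rightarrow> 'q \<Rightarrow> 'q) \<Rightarrow> bool" where
  "self_distributive_on Q f \<longleftrightarrow> (\<forall>p\<in>Q. \<forall>q\<in>Q. \<forall>r\<in>Q. f (f p q) r = f (f p r) (f q r))"

definition idempotent_on :: "'q set \<Rightarrow> ('q \<Rightarrow> 'q \<Rightarrow> 'q) \<Rightarrow> bool" where
  "idempotent_on Q f \<longleftrightarrow> (\<forall>q\<in>Q. f q q = q)"

locale pseudoquandle =
  fixes Q :: "'q set" and f :: "'q \<Rightarrow> 'q \<Rightarrow> 'q"
  assumes closed: "\<lbrakk>p \<in> Q; q \<in> Q\<rbrakk> \<Longrightarrow> f p q \<in> Q"
    and idempotent: "idempotent_on Q f"
    and self_distributive: "self_distributive_on Q f"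

locale commutative_pseudoquandle = pseudoquandle +
  assumes commutative: "\<lbrakk>p \<in> Q; q \<in> Q\<rbrakk> \<Longrightarrow> f p q = f q p"

definition normal_subgroups :: "('a, 'b) monoid_scheme \<Rightarrow> 'a set set" where
  "normal_subgroups G = {H. H \<lhd> G}"

text \<open>The operation on normal subgroups is the product of subsets \<^const>\<open>set_mult\<close>. A monoid
  record carries its unit, here the trivial subgroup.\<close>

definition normal_subgroup_monoid :: "('a, 'b) monoid_scheme \<Rightarrow> 'a set monoid" where
  "normal_subgroup_monoid G =
    \<lparr>carrier = normal_subgroups G, mult = set_mult G, one = {\<one>\<^bsub>G\<^esub>}\<rparr>"

end

theory Submission
  imports Defs "HOL-Algebra.SndIsomorphismGrp"
begin

text \<open>The product of two normal subgroups is again normal, multiplication of subsets inherits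
  associativity from \<open>G\<close>, and the trivial subgroup is its unit. Since aN = Na for
  normal N, also MN = NM, which gives the commutative monoid. A subgroup satisfies HH = H, and
  self-distributivity is then a formal consequence: in a commutative monoid of idempotents, (pr)(qr)
  = (pq)(rr) = (pq)r.\<close>

lemma comm_monoid_normal_subgroups:
  fixes G (structure)
  assumes "group G"
  shows "comm_monoid (normal_subgroup_monoid G)"
proof -
  interpret group G by fact
  have sub: "N \<subseteq> carrier G" if "N \<lhd> G" for N
    using that by (simp add: normal_imp_subgroup subgroup.subset)
  have one: "{\<one>} <#> N = N" if "N \<lhd> G" for N
    using sub[OF that] by (force simp: set_mult_def subset_iff)
  \<comment> \<open>MN is the union of the cosets aN = Na over a in M; here M enters just as a
    subgroup.\<close>
  have comm: "M <#> N = N <#> M" if "M \<lhd> G" "N \<lhd> G" for M N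
    using that by (simp only: commut_normal normal_imp_subgroup)
  show ?thesis
    by (rule comm_monoidI)
      (simp_all add: normal_subgroup_monoid_def normal_subgroups_def one_is_normal
        normal_subgroup_set_mult_closed set_mult_assoc sub one, rule comm)
qed

text \<open>Closure gives HH \<subseteq> H, and h = h1 gives the converse.\<close>

lemma idempotent_on_normal_subgroups:
  assumes "group G"
  shows "idempotent_on (normal_subgroups G) (set_mult G)"
  by (simp add: idempotent_on_def normal_subgroups_def
      group.subgroup_mult_id[OF assms] normal_imp_subgroup)

text \<open>Regrouping turns (pr)(qr) into (pq)(rr), and idempotence absorbs the second r. No group
  theory enters, so the argument lives in an abstract commutative monoid.\<close>

lemma (in comm_monoid) idempotent_imp_self_distributive:
  assumes "idempotent_on (carrier G) (\<otimes>)"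
  shows "self_distributive_on (carrier G) (\<otimes>)"
  unfolding self_distributive_on_def
proof (intro ballI)
  fix p q r
  assume "p \<in> carrier G" "q \<in> carrier G" and r: "r \<in> carrier G"
  moreover have "r \<otimes> r = r"
    using assms r by (simp add: idempotent_on_def)
  ultimately show "p \<otimes> q \<otimes> r = p \<otimes> r \<otimes> (q \<otimes> r)"
    by (metis m_assoc m_comm m_closed)
qed

theorem proposition1p2:
  fixes G :: "('a, 'b) monoid_scheme"
  assumes "group G"
  shows "comm_monoid (normal_subgroup_monoid G)
    \<and> self_distributive_on (normal_subgroups G) (set_mult G)
    \<and> idempotent_on (normal_subgroups G) (set_mult G)
    \<and> commutative_pseudoquandle (normal_subgroups G) (set_mult G)"
proof -
  let ?M = "normal_subgroup_monoid G"
  interpret M: comm_monoid ?M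
    using assms by (rule comm_monoid_normal_subgroups)
  \<comment> \<open>These equations carry facts about the abstract monoid over to normal subgroups
    and \<open>set_mult\<close>.\<close>
  have M: "carrier ?M = normal_subgroups G" "mult ?M = set_mult G"
    by (simp_all add: normal_subgroup_monoid_def)
  note idem = idempotent_on_normal_subgroups[OF assms]
  have dist: "self_distributive_on (normal_subgroups G) (set_mult G)"
    using M.idempotent_imp_self_distributive idem by (simp add: M)
  have "commutative_pseudoquandle (normal_subgroups G) (set_mult G)"
    using M.m_closed M.m_comm idem dist by unfold_locales (simp_all add: M)
  with M.comm_monoid_axioms idem dist show ?thesis
    by blast
qed

end
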